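(* Let $n\ge 2$ and $1\le d<n$. For any $f\in\mathcal{T}'$ and every $k\in\mathbb{Z}^n$, $$|\hat f(k)|=\max_{A\in G^n_d}\big|\widehat{R_df}(k,A)\big|.$$ In particular, for every $s\in\mathbb{R}$ the $d$-plane Radon transform $R_d:H^s\to R_d(H^s)$ is an isometry when the image $R_d(H^s)$ is equipped with the norm $$\|F\|_{R_d(H^s)}=\sqrt{\sum_{k\in\mathbb{Z}^n}\langle k\rangle^{2s}\max_{A\in G^n_d}|\hat F(k,A)|^2}.$$
   Context: $\mathbb{T}^n=\mathbb{R}^n/\mathbb{Z}^n$; $\mathcal{T}=C^\infty(\mathbb{T}^n)$ (complex-valued) and $\mathcal{T}'$ is its dual, the space of distributions on $\mathbb{T}^n$; $\langle\cdot,\cdot\rangle$ is the bilinear duality pairing extending $\int_{\mathbb{T}^n}f\eta\,dx$. $G^n_d$ is the set of unordered linearly independent $d$-tuples $A=\{v_1,\dots,v_d\}$ of vectors in $\mathbb{Z}^n\setminus\{0\}$. For $f\in\mathcal{T}$, the $d$-plane Radon transform is $R_df(x,A)=\int_{[0,1]^d}f(x+t_1v_1+\dots+t_dv_d)\,dt_1\cdots dt_d$. For $f\in\mathcal{T}'$, $R_df(\cdot,A)\in\mathcal{T}'$ is defined by $\langle R_df(\cdot,A),\eta\rangle=\langle f,R_d\eta(\cdot,A)\rangle$ for all $\eta\in\mathcal{T}$. With $e_k(x)=\exp(2\pi i k\cdot x)$, the Fourier coefficients of $f\in\mathcal{T}'$ are $\hat f(k)=\langle f,e_{-k}\rangle$,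 $k\in\mathbb{Z}^n$. For a family $F=(F(\cdot,A))_{A\in G^n_d}$ of distributions, $\hat F(k,A)$ is the $k$-th Fourier coefficient of $F(\cdot,A)$ (Fourier transform with respect to the variable on $\mathbb{T}^n$ only). $\langle k\rangle=\sqrt{1+|k|^2}$, and $H^s\subset\mathcal{T}'$ is the Sobolev space of those $f$ for which the norm $\|f\|_{H^s}=\sqrt{\sum_{k\in\mathbb{Z}^n}\langle k\rangle^{2s}|\hat f(k)|^2}$ is finite. *)

theory Defs
  imports "HOL-Analysis.Analysis" "HOL-Library.Function_Algebras"
begin

section \<open>Test functions on the torus\<close>

definition int_lattice :: "(real ^ 'n) set" where
  "int_lattice = {k. \<forall>i. k $ i \<in> \<int>}"

definition partial_deriv :: "'n::finite \<Rightarrow> (real ^ 'n \<Rightarrow> complex) \<Rightarrow> real ^ 'n \<Rightarrow> complex" where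
  "partial_deriv i f x = vector_derivative (\<lambda>t. f (x + t *\<^sub>R axis i 1)) (at 0)"

definition iter_deriv :: "'n::finite list \<Rightarrow> (real ^ 'n \<Rightarrow> complex) \<Rightarrow> real ^ 'n \<Rightarrow> complex" where
  "iter_deriv is f = foldr partial_deriv is f"

text \<open>Functions on the torus are identified with lattice-periodic functions on the
  covering space. Differentiability of every iterated partial derivative implies that all
  of them exist and are continuous.\<close>

definition test_fun :: "(real ^ 'n::finite \<Rightarrow> complex) set" where
  "test_fun = {f. (\<forall>x. \<forall>m\<in>int_lattice. f (x + m) = f x) \<and>
                  (\<forall>is x. iter_deriv is f differentiable (at x))}"

definition test_seminorm :: "'n::finite list \<Rightarrow> (real ^ 'n \<Rightarrow> complex) \<Rightarrow> real" where
  "test_seminorm is f = (SUP x. cmod (iter_deriv is f x))"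

definition test_topology :: "(real ^ 'n::finite \<Rightarrow> complex) topology" where
  "test_topology = topology_generated_by
     {{g \<in> test_fun. test_seminorm is (g - f) < \<epsilon>} | is f \<epsilon>. f \<in> test_fun \<and> 0 < \<epsilon>}"

section \<open>Distributions\<close>

text \<open>The duality pairing of \<open>u\<close> and \<open>\<phi>\<close> is the value \<open>u \<phi>\<close>. Functionals
  are set to 0 outside the test functions, so that equality of distributions is equality
  in HOL. Sums of functionals are pointwise.\<close>

definition distributions :: "((real ^ 'n::finite \<Rightarrow> complex) \<Rightarrow> complex) set" where
  "distributions = {u.
     (\<forall>\<phi>\<in>test_fun. \<forall>\<psi>\<in>test_fun. u (\<phi> + \<psi>) = u \<phi> + u \<psi>) \<and>
     (\<forall>c. \<forall>\<phi>\<in>test_fun. u (\<lambda>x. c * \<phi> x) = c * u \<phi>) \<and>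
     continuous_map test_topology euclidean u \<and>
     (\<forall>\<phi>. \<phi> \<notin> test_fun \<longrightarrow> u \<phi> = 0)}"

definition character :: "real ^ 'n::finite \<Rightarrow> real ^ 'n \<Rightarrow> complex" where
  "character k x = exp (2 * of_real pi * \<i> * of_real (k \<bullet> x))"

definition fourier_coeff ::
  "((real ^ 'n::finite \<Rightarrow> complex) \<Rightarrow> complex) \<Rightarrow> real ^ 'n \<Rightarrow> complex" where
  "fourier_coeff u k = u (character (- k))"

section \<open>The plane Radon transform\<close>

definition direction_sets :: "nat \<Rightarrow> (real ^ 'n::finite) set set" where
  "direction_sets d = {A. A \<subseteq> int_lattice - {0} \<and> finite A \<and> card A = d \<and> independent A}"

text \<open>The cube is indexed by the elements of \<open>A\<close> itself, with \<open>t v\<close> the parameter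
  belonging to \<open>v\<close>; no enumeration of \<open>A\<close> is needed.\<close>

definition radon_test ::
  "(real ^ 'n::finite \<Rightarrow> complex) \<Rightarrow> (real ^ 'n) set \<Rightarrow> real ^ 'n \<Rightarrow> complex" where
  "radon_test f A x =
     set_lebesgue_integral (Pi\<^sub>M A (\<lambda>_. lborel)) (Pi\<^sub>E A (\<lambda>_. {0..1}))
       (\<lambda>t. f (x + (\<Sum>v\<in>A. t v *\<^sub>R v)))"

text \<open>Families indexed by the direction sets are set to 0 at all other index values.\<close>

definition radon :: "nat \<Rightarrow> ((real ^ 'n::finite \<Rightarrow> complex) \<Rightarrow> complex) \<Rightarrow>
    (real ^ 'n) set \<Rightarrow> (real ^ 'n \<Rightarrow> complex) \<Rightarrow> complex" where
  "radon d u A \<phi> =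
     (if A \<in> direction_sets d \<and> \<phi> \<in> test_fun then u (radon_test \<phi> A) else 0)"

section \<open>Maxima and norms\<close>

definition is_max_over :: "real \<Rightarrow> ('a \<Rightarrow> real) \<Rightarrow> 'a set \<Rightarrow> bool" where
  "is_max_over m g S \<longleftrightarrow> m \<in> g ` S \<and> (\<forall>a\<in>S. g a \<le> m)"

text \<open>The library's \<^const>\<open>Max\<close> is restricted to finite sets.\<close>

definition max_over :: "('a \<Rightarrow> real) \<Rightarrow> 'a set \<Rightarrow> real" where
  "max_over g S = (THE m. is_max_over m g S)"

definition jbracket :: "real ^ 'n::finite \<Rightarrow> real" where
  "jbracket k = sqrt (1 + (norm k)\<^sup>2)"

definition sobolev_term ::
  "real \<Rightarrow> ((real ^ 'n::finite \<Rightarrow> complex) \<Rightarrow> complex) \<Rightarrow> real ^ 'n \<Rightarrow> real" where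
  "sobolev_term s u k = jbracket k powr (2 * s) * (cmod (fourier_coeff u k))\<^sup>2"

definition sobolev_norm :: "real \<Rightarrow> ((real ^ 'n::finite \<Rightarrow> complex) \<Rightarrow> complex) \<Rightarrow> real" where
  "sobolev_norm s u = sqrt (\<Sum>\<^sub>\<infinity>k\<in>int_lattice. sobolev_term s u k)"

text \<open>A non-summable \<^const>\<open>infsum\<close> is 0, so finiteness of the norm has to be stated as
  summability.\<close>

definition sobolev_space :: "real \<Rightarrow> ((real ^ 'n::finite \<Rightarrow> complex) \<Rightarrow> complex) set" where
  "sobolev_space s = {u \<in> distributions. sobolev_term s u summable_on int_lattice}"

definition radon_term :: "nat \<Rightarrow> real \<Rightarrow>
    ((real ^ 'n::finite) set \<Rightarrow> (real ^ 'n \<Rightarrow> complex) \<Rightarrow> complex) \<Rightarrow> real ^ 'n \<Rightarrow> real" where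
  "radon_term d s F k =
     jbracket k powr (2 * s) * max_over (\<lambda>A. (cmod (fourier_coeff (F A) k))\<^sup>2) (direction_sets d)"

definition radon_norm :: "nat \<Rightarrow> real \<Rightarrow>
    ((real ^ 'n::finite) set \<Rightarrow> (real ^ 'n \<Rightarrow> complex) \<Rightarrow> complex) \<Rightarrow> real" where
  "radon_norm d s F = sqrt (\<Sum>\<^sub>\<infinity>k\<in>int_lattice. radon_term d s F k)"

section \<open>Isometries of normed spaces\<close>

definition dist_scale :: "complex \<Rightarrow> ('a \<Rightarrow> complex) \<Rightarrow> 'a \<Rightarrow> complex" where
  "dist_scale c u = (\<lambda>\<phi>. c * u \<phi>)"

definition family_scale :: "complex \<Rightarrow> ('b \<Rightarrow> 'a \<Rightarrow> complex) \<Rightarrow> 'b \<Rightarrow> 'a \<Rightarrow> complex" where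
  "family_scale c F = (\<lambda>A. dist_scale c (F A))"

definition normed_space_on ::
  "(complex \<Rightarrow> 'v \<Rightarrow> 'v) \<Rightarrow> 'v::ab_group_add set \<Rightarrow> ('v \<Rightarrow> real) \<Rightarrow> bool" where
  "normed_space_on sc V N \<longleftrightarrow>
     vector_space sc \<and> module.subspace sc V \<and>
     (\<forall>x\<in>V. 0 \<le> N x \<and> (N x = 0 \<longleftrightarrow> x = 0)) \<and>
     (\<forall>c. \<forall>x\<in>V. N (sc c x) = cmod c * N x) \<and>
     (\<forall>x\<in>V. \<forall>y\<in>V. N (x + y) \<le> N x + N y)"

definition linear_isometry ::
  "(complex \<Rightarrow> 'v \<Rightarrow> 'v) \<Rightarrow> 'v::ab_group_add set \<Rightarrow> ('v \<Rightarrow> real) \<Rightarrow>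
   (complex \<Rightarrow> 'w \<Rightarrow> 'w) \<Rightarrow> 'w::ab_group_add set \<Rightarrow> ('w \<Rightarrow> real) \<Rightarrow> ('v \<Rightarrow> 'w) \<Rightarrow> bool" where
  "linear_isometry sc V N sc' W N' T \<longleftrightarrow>
     normed_space_on sc V N \<and> normed_space_on sc' W N' \<and>
     bij_betw T V W \<and>
     (\<forall>x\<in>V. \<forall>y\<in>V. T (x + y) = T x + T y) \<and>
     (\<forall>c. \<forall>x\<in>V. T (sc c x) = sc' c (T x)) \<and>
     (\<forall>x\<in>V. N' (T x) = N x)"

end

theory Submission
  imports Defs
begin

text \<open>
  Write \<open>e\<^sub>k\<close> for the character \<open>x \<mapsto> exp (2\<pi>\<i> k \<bullet> x)\<close>. Along the cube spanned by a direction
  set \<open>A\<close> the character \<open>e\<^sub>k\<close> factors, so averaging it gives \<open>e\<^sub>k\<close> times the product over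
  \<open>v \<in> A\<close> of the integrals of \<open>exp (2\<pi>\<i> t (k \<bullet> v))\<close> over \<open>0 \<le> t \<le> 1\<close>. Each \<open>k \<bullet> v\<close> is an integer,
  hence the average is \<open>e\<^sub>k\<close> if \<open>A\<close> is orthogonal to \<open>k\<close>, and \<open>0\<close> otherwise
  (\<open>radon_test_character\<close>). By duality the \<open>k\<close>-th Fourier coefficient of \<open>R\<^sub>d u\<close> at \<open>A\<close> is either
  that of \<open>u\<close> or \<open>0\<close>. The lattice vectors orthogonal to \<open>k\<close> span a space of dimension at least
  \<open>n - 1 \<ge> d\<close>, so some direction set realises the first alternative
  (\<open>exists_orthogonal_direction_set\<close>), and the maximum formula follows. It turns the norm of the
  image into the Sobolev norm term by term; injectivity of \<open>R\<^sub>d\<close> and the norm axioms on the image are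
  then formal consequences (\<open>linear_isometry_onto_image\<close>) of the Sobolev norm being a norm.

  The analytic content is that the Sobolev norm is definite: a distribution whose Fourier
  coefficients all vanish is zero (\<open>distribution_eq_0I\<close>). By continuity this amounts to the density
  of the trigonometric polynomials in the test functions, where finitely many derivatives have
  to be approximated uniformly at once. The operators \<open>1 - \<partial>\<^sub>i\<close> reduce this to plain uniform
  approximation. For a periodic function \<open>h\<close>, a point where \<open>\<bar>h\<bar>\<close> is maximal shows
  \<open>sup \<bar>h\<bar> \<le> sup \<bar>h - \<partial>\<^sub>i h\<bar>\<close> (\<open>damped_max_principle\<close>), and therefore also
  \<open>sup \<bar>\<partial>\<^sub>i h\<bar> \<le> 2 sup \<bar>h - \<partial>\<^sub>i h\<bar>\<close>. As these operators commute with each other and with all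
  derivatives, a suitable product \<open>L\<close> of them controls any finite set of derivatives
  (\<open>bound_finitely_many_derivs\<close>). Moreover \<open>e\<^sub>k\<close> is an eigenvector of \<open>1 - \<partial>\<^sub>i\<close> with eigenvalue
  \<open>1 - 2\<pi>\<i> k\<^sub>i \<noteq> 0\<close>, so \<open>L\<close> maps the trigonometric polynomials onto themselves. Thus if \<open>q\<close> is a
  trigonometric polynomial uniformly close to \<open>L \<phi>\<close>, which exists by the Stone-Weierstrass theorem
  on the torus (\<open>trig_poly_dense\<close>), and \<open>L p = q\<close>, then \<open>p\<close> is close to \<open>\<phi>\<close> together with the
  prescribed derivatives.
\<close>

section \<open>Partial derivatives of test functions\<close>

text \<open>The second difference of \<open>F\<close> over a square of side \<open>h\<close> is, by applying the mean value theorem in one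
  variable and then in the other, \<open>h\<^sup>2\<close> times either mixed derivative at some point of the square.
  Continuity at the origin gives equality as \<open>h\<close> tends to \<open>0\<close>.\<close>

lemma equal_mixed_partials_real:
  fixes F Fs Ft Fst Fts :: "real \<Rightarrow> real \<Rightarrow> real"
  assumes Fs: "\<And>s t. ((\<lambda>s. F s t) has_real_derivative Fs s t) (at s)"
    and Ft: "\<And>s t. ((\<lambda>t. F s t) has_real_derivative Ft s t) (at t)"
    and Fst: "\<And>s t. ((\<lambda>t. Fs s t) has_real_derivative Fst s t) (at t)"
    and Fts: "\<And>s t. ((\<lambda>s. Ft s t) has_real_derivative Fts s t) (at s)"
    and cont: "isCont (\<lambda>p. Fst (fst p) (snd p)) (0, 0)" "isCont (\<lambda>p. Fts (fst p) (snd p)) (0, 0)"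
  shows "Fst 0 0 = Fts 0 0"
proof -
  have mean: "\<exists>\<sigma> \<tau>. 0 < \<sigma> \<and> \<sigma> < h \<and> 0 < \<tau> \<and> \<tau> < h \<and>
      H h h - H h 0 - H 0 h + H 0 0 = h * h * Hst \<sigma> \<tau>"
    if Hs: "\<And>s t. ((\<lambda>s. H s t) has_real_derivative Hs s t) (at s)"
      and Hst: "\<And>s t. ((\<lambda>t. Hs s t) has_real_derivative Hst s t) (at t)" and h: "0 < h"
    for H Hs Hst :: "real \<Rightarrow> real \<Rightarrow> real" and h
  proof -
    obtain \<sigma> where \<sigma>: "0 < \<sigma>" "\<sigma> < h"
      "(H h h - H h 0) - (H 0 h - H 0 0) = (h - 0) * (Hs \<sigma> h - Hs \<sigma> 0)"
      using MVT2[OF h DERIV_diff[OF Hs Hs]] by blast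
    obtain \<tau> where \<tau>: "0 < \<tau>" "\<tau> < h" "Hs \<sigma> h - Hs \<sigma> 0 = (h - 0) * Hst \<sigma> \<tau>"
      using MVT2[OF h Hst] by blast
    have "H h h - H h 0 - H 0 h + H 0 0 = (H h h - H h 0) - (H 0 h - H 0 0)" by simp
    also have "\<dots> = h * h * Hst \<sigma> \<tau>" using \<sigma>(3) \<tau>(3) by simp
    finally show ?thesis using \<sigma> \<tau> by blast
  qed
  show ?thesis
  proof (rule ccontr)
    assume neq: "Fst 0 0 \<noteq> Fts 0 0"
    \<comment> \<open>Half the gap: two values closer than \<open>e\<close> to the two derivatives cannot coincide.\<close>
    define e where "e = \<bar>Fst 0 0 - Fts 0 0\<bar> / 2"
    have e: "e > 0" using neq by (simp add: e_def)
    obtain d1 where d1: "d1 > 0" "\<And>p. dist p (0, 0) < d1 \<Longrightarrow> \<bar>Fst (fst p) (snd p) - Fst 0 0\<bar> < e"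
      using cont(1) e unfolding continuous_at_eps_delta dist_real_def fst_conv snd_conv by metis
    obtain d2 where d2: "d2 > 0" "\<And>p. dist p (0, 0) < d2 \<Longrightarrow> \<bar>Fts (fst p) (snd p) - Fts 0 0\<bar> < e"
      using cont(2) e unfolding continuous_at_eps_delta dist_real_def fst_conv snd_conv by metis
    define h where "h = min d1 d2 / 2"
    have h: "h > 0" using d1(1) d2(1) by (simp add: h_def)
    have near: "dist (a, b) (0, 0) < min d1 d2" if "0 < a" "a < h" "0 < b" "b < h" for a b :: real
    proof -
      have "dist (a, b) (0, 0) \<le> \<bar>a\<bar> + \<bar>b\<bar>"
        using sqrt_sum_squares_le_sum_abs[of a b] by (simp add: dist_Pair_Pair dist_real_def)
      thus ?thesis using that by (simp add: h_def)
    qed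
    obtain a b where ab: "0 < a" "a < h" "0 < b" "b < h"
      "F h h - F h 0 - F 0 h + F 0 0 = h * h * Fst a b"
      using mean[OF Fs Fst h] by blast
    \<comment> \<open>The second difference is symmetric under exchanging the variables.\<close>
    obtain c d where cd: "0 < c" "c < h" "0 < d" "d < h"
      "F h h - F 0 h - F h 0 + F 0 0 = h * h * Fts c d"
      using mean[of "\<lambda>s t. F t s" "\<lambda>s t. Ft t s" "\<lambda>s t. Fts t s" h] Ft Fts h by blast
    have "h * h * Fst a b = h * h * Fts c d" using ab(5) cd(5) by linarith
    hence "Fst a b = Fts c d" using h by simp
    moreover have "\<bar>Fst a b - Fst 0 0\<bar> < e" using d1(2)[of "(a, b)"] near[OF ab(1-4)] by simp
    moreover have "\<bar>Fts c d - Fts 0 0\<bar> < e" using d2(2)[of "(c, d)"] near[OF cd(1-4)] by simp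
    ultimately have "\<bar>Fst 0 0 - Fts 0 0\<bar> < e + e" by linarith
    thus False unfolding e_def by simp
  qed
qed

lemma has_vector_derivative_partial_deriv:
  assumes "f differentiable (at (x + t *\<^sub>R axis i 1))"
  shows "((\<lambda>t. f (x + t *\<^sub>R axis i 1)) has_vector_derivative
          partial_deriv i f (x + t *\<^sub>R axis i 1)) (at t)"
proof -
  let ?y = "x + t *\<^sub>R axis i 1"
  have "(\<lambda>s. f (?y + s *\<^sub>R axis i 1)) differentiable (at 0)"
    using assms by (intro differentiable_compose[of f "\<lambda>s. ?y + s *\<^sub>R axis i 1"]) simp_all
  hence "((\<lambda>s. f (?y + s *\<^sub>R axis i 1)) has_vector_derivative partial_deriv i f ?y) (at 0)"
    unfolding partial_deriv_def by (simp flip: vector_derivative_works)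
  moreover have "((\<lambda>s. s - t) has_vector_derivative 1) (at t)"
    by (auto intro!: derivative_eq_intros)
  ultimately have "((\<lambda>s. f (?y + (s - t) *\<^sub>R axis i 1)) has_vector_derivative partial_deriv i f ?y) (at t)"
    using vector_diff_chain_at[of "\<lambda>s. s - t" 1 t "\<lambda>s. f (?y + s *\<^sub>R axis i 1)"] by (simp add: o_def)
  moreover have "(\<lambda>s. f (?y + (s - t) *\<^sub>R axis i 1)) = (\<lambda>s. f (x + s *\<^sub>R axis i 1))"
    by (simp add: algebra_simps)
  ultimately show ?thesis by simp
qed

lemma partial_deriv_eqI:
  assumes "((\<lambda>t. f (x + t *\<^sub>R axis i 1)) has_vector_derivative D) (at 0)"
  shows "partial_deriv i f x = D"
  using vector_derivative_at[OF assms] by (simp add: partial_deriv_def)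

lemma iter_deriv_Nil [simp]: "iter_deriv [] f = f"
  and iter_deriv_Cons [simp]: "iter_deriv (i # is) f = partial_deriv i (iter_deriv is f)"
  and iter_deriv_append: "iter_deriv (is @ js) f = iter_deriv is (iter_deriv js f)"
  by (simp_all add: iter_deriv_def)

lemma test_funD:
  assumes "f \<in> test_fun"
  shows "m \<in> int_lattice \<Longrightarrow> f (x + m) = f x" "iter_deriv is f differentiable (at x)"
    "f differentiable (at x)"
proof -
  have all: "\<forall>m\<in>int_lattice. f (x + m) = f x" "\<forall>is. iter_deriv is f differentiable (at x)"
    using assms by (auto simp: test_fun_def)
  show "m \<in> int_lattice \<Longrightarrow> f (x + m) = f x" "iter_deriv is f differentiable (at x)"
    using all by blast+
  show "f differentiable (at x)" using all(2)[rule_format, of "[]"] by simp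
qed

lemma partial_deriv_in_test_fun:
  assumes f: "f \<in> test_fun"
  shows "partial_deriv i f \<in> test_fun"
proof -
  have "partial_deriv i f (x + m) = partial_deriv i f x" if "m \<in> int_lattice" for x m
  proof -
    have "f (x + m + t *\<^sub>R axis i 1) = f (x + t *\<^sub>R axis i 1)" for t
      using test_funD(1)[OF f that, of "x + t *\<^sub>R axis i 1"] by (simp add: algebra_simps)
    thus ?thesis by (simp add: partial_deriv_def)
  qed
  moreover have "iter_deriv is (partial_deriv i f) differentiable (at x)" for "is" x
    using test_funD(2)[OF f, of "is @ [i]" x] by (simp add: iter_deriv_append)
  ultimately show ?thesis by (simp add: test_fun_def)
qed

lemma iter_deriv_in_test_fun: "f \<in> test_fun \<Longrightarrow> iter_deriv is f \<in> test_fun"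
  by (induction "is") (auto intro: partial_deriv_in_test_fun)

lemma partial_deriv_lincomb:
  assumes "f differentiable (at x)" "g differentiable (at x)"
  shows "partial_deriv i (\<lambda>x. a * f x + b * g x) x = a * partial_deriv i f x + b * partial_deriv i g x"
proof (rule partial_deriv_eqI)
  have "((\<lambda>t. f (x + t *\<^sub>R axis i 1)) has_vector_derivative partial_deriv i f x) (at 0)"
    "((\<lambda>t. g (x + t *\<^sub>R axis i 1)) has_vector_derivative partial_deriv i g x) (at 0)"
    using has_vector_derivative_partial_deriv[of f x 0 i] has_vector_derivative_partial_deriv[of g x 0 i] assms
    by simp_all
  thus "((\<lambda>t. a * f (x + t *\<^sub>R axis i 1) + b * g (x + t *\<^sub>R axis i 1)) has_vector_derivative
      a * partial_deriv i f x + b * partial_deriv i g x) (at 0)"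
    by (intro has_vector_derivative_add has_vector_derivative_mult_right)
qed

text \<open>Stated with both coefficients at once, so that sums, differences and multiples are
  all instances.\<close>

lemma iter_deriv_lincomb:
  assumes "f \<in> test_fun" "g \<in> test_fun"
  shows "iter_deriv is (\<lambda>x. a * f x + b * g x) = (\<lambda>x. a * iter_deriv is f x + b * iter_deriv is g x)"
proof (induction "is")
  case (Cons i "is")
  thus ?case
    using assms by (auto simp: partial_deriv_lincomb test_funD(2))
qed simp

lemma test_fun_lincomb:
  assumes "f \<in> test_fun" "g \<in> test_fun"
  shows "(\<lambda>x. a * f x + b * g x) \<in> test_fun"
  using assms
  by (auto simp: test_fun_def iter_deriv_lincomb[OF assms] intro!: differentiable_add differentiable_mult)

lemma test_fun_diff: "f \<in> test_fun \<Longrightarrow> g \<in> test_fun \<Longrightarrow> f - g \<in> test_fun"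
  and test_fun_scale: "f \<in> test_fun \<Longrightarrow> (\<lambda>x. c * f x) \<in> test_fun"
  using test_fun_lincomb[of f g 1 "-1"] test_fun_lincomb[of f f c 0]
  by (simp_all add: plus_fun_def fun_diff_def)

lemma iter_deriv_diff:
    "f \<in> test_fun \<Longrightarrow> g \<in> test_fun \<Longrightarrow> iter_deriv is (f - g) = iter_deriv is f - iter_deriv is g"
  and iter_deriv_scale: "f \<in> test_fun \<Longrightarrow> iter_deriv is (\<lambda>x. c * f x) = (\<lambda>x. c * iter_deriv is f x)"
  using iter_deriv_lincomb[of f g "is" 1 "-1"] iter_deriv_lincomb[of f f "is" c 0]
  by (simp_all add: plus_fun_def fun_diff_def)

lemma continuous_on_test_fun: "f \<in> test_fun \<Longrightarrow> continuous_on S f"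
  by (meson continuous_at_imp_continuous_on differentiable_imp_continuous_within test_funD(3))

text \<open>The mean value theorem needs real values, so the symmetry of the mixed derivatives is obtained for
  the real and the imaginary part separately.\<close>

lemma partial_deriv_commute:
  assumes f: "f \<in> test_fun"
  shows "partial_deriv i (partial_deriv j f) = partial_deriv j (partial_deriv i f)"
proof
  fix x
  let ?p = "\<lambda>s t. x + s *\<^sub>R axis i 1 + t *\<^sub>R axis j (1::real)"
  have real_valued: "\<phi> (partial_deriv i (partial_deriv j f) x) = \<phi> (partial_deriv j (partial_deriv i f) x)"
    if \<phi>: "bounded_linear \<phi>" for \<phi> :: "complex \<Rightarrow> real"
  proof -
    have ds: "((\<lambda>s. \<phi> (g (?p s t))) has_real_derivative \<phi> (partial_deriv i g (?p s t))) (at s)"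
      if "g \<in> test_fun" for g s t
      using bounded_linear.has_vector_derivative[OF \<phi>
          has_vector_derivative_partial_deriv[of g "x + t *\<^sub>R axis j 1" s i]] test_funD(3)[OF that]
      by (simp add: has_real_derivative_iff_has_vector_derivative add.commute add.left_commute)
    have dt: "((\<lambda>t. \<phi> (g (?p s t))) has_real_derivative \<phi> (partial_deriv j g (?p s t))) (at t)"
      if "g \<in> test_fun" for g s t
      using bounded_linear.has_vector_derivative[OF \<phi>
          has_vector_derivative_partial_deriv[of g "x + s *\<^sub>R axis i 1" t j]] test_funD(3)[OF that]
      by (simp add: has_real_derivative_iff_has_vector_derivative)
    have cont: "isCont (\<lambda>p. \<phi> (g (?p (fst p) (snd p)))) (0, 0)" if "g \<in> test_fun" for g
    proof (rule continuous_on_interior[where S = UNIV])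
      show "continuous_on UNIV (\<lambda>p. \<phi> (g (?p (fst p) (snd p))))"
        by (intro continuous_on_compose2[OF continuous_on_test_fun[OF that, of UNIV]]
            continuous_on_compose2[OF linear_continuous_on[OF \<phi>, of UNIV]] continuous_intros) auto
    qed simp
    note pd = partial_deriv_in_test_fun[OF f] partial_deriv_in_test_fun[OF partial_deriv_in_test_fun[OF f]]
    show ?thesis
      using equal_mixed_partials_real[OF ds[OF f] dt[OF f] dt[OF pd(1)] ds[OF pd(1)] cont[OF pd(2)] cont[OF pd(2)]]
      by simp
  qed
  show "partial_deriv i (partial_deriv j f) x = partial_deriv j (partial_deriv i f) x"
    using real_valued[OF bounded_linear_Re] real_valued[OF bounded_linear_Im] by (rule complex_eqI)
qed

section \<open>Characters\<close>

lemma int_lattice_add: "k \<in> int_lattice \<Longrightarrow> l \<in> int_lattice \<Longrightarrow> k + l \<in> int_lattice"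
  and int_lattice_uminus: "k \<in> int_lattice \<Longrightarrow> - k \<in> int_lattice"
  and int_lattice_0: "0 \<in> int_lattice"
  and int_lattice_axis: "axis i 1 \<in> int_lattice"
  by (auto simp: int_lattice_def axis_def)

lemma inner_int_lattice: "k \<in> int_lattice \<Longrightarrow> l \<in> int_lattice \<Longrightarrow> k \<bullet> l \<in> \<int>"
  unfolding int_lattice_def inner_vec_def by (auto intro!: Ints_sum)

lemma exp_2pi_i_int: "x \<in> \<int> \<Longrightarrow> exp (2 * of_real pi * \<i> * of_real x) = 1"
  by (auto elim!: Ints_cases simp: exp_eq_1 algebra_simps)

lemma character_add: "character k (x + y) = character k x * character k y"
  and character_mult: "character k x * character l x = character (k + l) x"
  and character_0: "character 0 x = 1"
  by (simp_all add: character_def inner_add_right inner_add_left distrib_left mult_exp_exp)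

lemma character_int_lattice: "k \<in> int_lattice \<Longrightarrow> m \<in> int_lattice \<Longrightarrow> character k m = 1"
  by (simp add: character_def exp_2pi_i_int inner_int_lattice)

lemma partial_deriv_character:
  "partial_deriv i (character k) x = 2 * of_real pi * \<i> * of_real (k $ i) * character k x"
proof (rule partial_deriv_eqI)
  let ?c = "2 * of_real pi * \<i> * of_real (k $ i)"
  have "((\<lambda>t. exp (?c * of_real t) * character k x) has_vector_derivative ?c * character k x) (at 0)"
    by (auto intro!: derivative_eq_intros has_vector_derivative_real_field simp: field_simps)
  moreover have "character k (t *\<^sub>R axis i 1) = exp (?c * of_real t)" for t
    by (simp add: character_def inner_axis mult_ac)
  hence "exp (?c * of_real t) * character k x = character k (x + t *\<^sub>R axis i 1)" for t
    by (simp add: character_add)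
  ultimately show "((\<lambda>t. character k (x + t *\<^sub>R axis i 1)) has_vector_derivative ?c * character k x) (at 0)"
    by simp
qed

lemma differentiable_character: "character k differentiable (at x)"
proof -
  have "((\<lambda>x. 2 * of_real pi * \<i> * of_real (k \<bullet> x) :: complex) has_derivative
      (\<lambda>h. 2 * of_real pi * \<i> * of_real (k \<bullet> h))) (at x)"
    by (auto intro!: derivative_eq_intros)
  from has_derivative_compose[OF this DERIV_exp[unfolded has_field_derivative_def]]
  show ?thesis unfolding character_def[abs_def] differentiable_def by blast
qed

lemma iter_deriv_character: "\<exists>c. iter_deriv is (character k) = (\<lambda>x. c * character k x)"
proof (induction "is")
  case Nil
  show ?case by (auto intro: exI[of _ 1])
next
  case (Cons i "is")
  then obtain c where c: "iter_deriv is (character k) = (\<lambda>x. c * character k x)" by blast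
  have "partial_deriv i (\<lambda>x. c * character k x) x =
      c * (2 * of_real pi * \<i> * of_real (k $ i)) * character k x" for x
    using partial_deriv_lincomb[OF differentiable_character differentiable_character, of i c k 0 k x]
    by (simp add: partial_deriv_character)
  thus ?case unfolding iter_deriv_Cons c by blast
qed

lemma character_in_test_fun: "k \<in> int_lattice \<Longrightarrow> character k \<in> test_fun"
proof -
  assume k: "k \<in> int_lattice"
  have "iter_deriv is (character k) differentiable (at x)" for "is" x
    using iter_deriv_character[of "is" k]
    by (auto intro!: differentiable_mult differentiable_character)
  thus ?thesis by (simp add: test_fun_def character_add character_int_lattice[OF k])
qed

section \<open>Uniform density of the trigonometric polynomials\<close>

text \<open>Adding one character at a time gives an induction rule under which linear
  properties reduce to characters.\<close>

inductive_set trig_poly :: "(real ^ 'n::finite \<Rightarrow> complex) set" where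
  zero: "(\<lambda>x. 0) \<in> trig_poly"
| add_character: "p \<in> trig_poly \<Longrightarrow> k \<in> int_lattice \<Longrightarrow> (\<lambda>x. c * character k x + p x) \<in> trig_poly"

lemma trig_poly_in_test_fun: "p \<in> trig_poly \<Longrightarrow> p \<in> test_fun"
proof (induction rule: trig_poly.induct)
  case zero
  show ?case
    using test_fun_scale[OF character_in_test_fun[OF int_lattice_0], of 0] by simp
next
  case (add_character p k c)
  show ?case
    using test_fun_lincomb[OF character_in_test_fun[OF add_character.hyps(2)] add_character.IH, of c 1] by simp
qed

lemma trig_poly_character: "k \<in> int_lattice \<Longrightarrow> (\<lambda>x. c * character k x) \<in> trig_poly"
  using trig_poly.add_character[OF trig_poly.zero, of k c] by simp

lemma trig_poly_const: "(\<lambda>x. c) \<in> trig_poly"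
  using trig_poly_character[OF int_lattice_0, of c] by (simp add: character_0)

lemma trig_poly_add: "p \<in> trig_poly \<Longrightarrow> q \<in> trig_poly \<Longrightarrow> (\<lambda>x. p x + q x) \<in> trig_poly"
proof (induction rule: trig_poly.induct)
  case (add_character p k c)
  thus ?case using trig_poly.add_character[of "\<lambda>x. p x + q x" k c] by (simp add: add.assoc)
qed simp

lemma trig_poly_mult_character:
  assumes "p \<in> trig_poly" "k \<in> int_lattice"
  shows "(\<lambda>x. c * character k x * p x) \<in> trig_poly"
  using assms
proof (induction rule: trig_poly.induct)
  case zero
  show ?case using trig_poly.zero by simp
next
  case (add_character p l b)
  have "(\<lambda>x. (c * b) * character (k + l) x + c * character k x * p x) \<in> trig_poly"
    using add_character by (intro trig_poly.add_character int_lattice_add) auto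
  moreover have "c * character k x * (b * character l x + p x) =
      (c * b) * character (k + l) x + c * character k x * p x" for x
    by (simp add: algebra_simps flip: character_mult)
  ultimately show ?case by simp
qed

lemma trig_poly_mult: "p \<in> trig_poly \<Longrightarrow> q \<in> trig_poly \<Longrightarrow> (\<lambda>x. p x * q x) \<in> trig_poly"
proof (induction rule: trig_poly.induct)
  case zero
  show ?case using trig_poly.zero by simp
next
  case (add_character p k c)
  thus ?case
    using trig_poly_add[OF trig_poly_mult_character[of q k c], of "\<lambda>x. p x * q x"]
    by (simp add: distrib_right)
qed

lemma unit_cube_representative:
  fixes x :: "real ^ 'n::finite"
  obtains y where "y \<in> cbox 0 (\<chi> i. 1)" "x - y \<in> int_lattice"
proof
  show "(\<chi> i. frac (x $ i)) \<in> cbox 0 (\<chi> i. 1)"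
    by (auto simp: mem_box_cart intro: less_imp_le frac_lt_1)
  show "x - (\<chi> i. frac (x $ i)) \<in> int_lattice"
    by (auto simp: int_lattice_def frac_def)
qed

lemma periodic_cong:
  assumes "\<And>x m. m \<in> int_lattice \<Longrightarrow> g (x + m) = g x" "x - y \<in> int_lattice"
  shows "g x = g y"
  using assms(1)[OF assms(2), of y] by simp

text \<open>The embedding of the torus as a product of circles. It turns periodic functions into functions on a
  compact set, on which the trigonometric polynomials separate points.\<close>

definition torus_map :: "real ^ 'n::finite \<Rightarrow> complex ^ 'n" where
  "torus_map x = (\<chi> i. character (axis i 1) x)"

lemma torus_map_eqD: "torus_map x = torus_map y \<Longrightarrow> x - y \<in> int_lattice"
proof -
  assume eq: "torus_map x = torus_map y"
  have "(x - y) $ i \<in> \<int>" for i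
  proof -
    have "character (axis i 1) x = character (axis i 1) y"
      using eq by (simp add: torus_map_def vec_eq_iff)
    then obtain n :: int where "2 * of_real pi * \<i> * of_real (axis i 1 \<bullet> x) =
        2 * of_real pi * \<i> * of_real (axis i 1 \<bullet> y) + of_int (2 * n) * (of_real pi * \<i>)"
      unfolding character_def exp_eq by auto
    hence "2 * pi * (x $ i) = 2 * pi * (y $ i) + 2 * n * pi"
      by (simp add: complex_eq_iff inner_axis')
    hence "2 * pi * ((x - y) $ i) = 2 * pi * n" by (simp add: algebra_simps)
    hence "(x - y) $ i = n" by simp
    thus ?thesis by simp
  qed
  thus ?thesis by (simp add: int_lattice_def)
qed

lemma torus_map_periodic: "m \<in> int_lattice \<Longrightarrow> torus_map (x + m) = torus_map x"
  by (simp add: torus_map_def character_add character_int_lattice int_lattice_axis)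

lemma continuous_on_torus_map: "continuous_on S torus_map"
  unfolding torus_map_def[abs_def]
  by (intro continuous_on_vec_lambda continuous_on_test_fun character_in_test_fun int_lattice_axis)

text \<open>A periodic function descends to a function \<open>G\<close> on the image of the torus map. This image is
  a quotient of the compact unit cube, so \<open>G\<close> is continuous. The real functions there that
  pull back to trigonometric polynomials contain the real and imaginary parts of the coordinates,
  since these pull back to \<open>(e\<^sub>k \<plusminus> e\<^bsub>-k\<^esub>) / 2\<close> up to a factor, with \<open>k\<close> a unit vector.\<close>

lemma trig_poly_dense_real:
  fixes g :: "real ^ 'n::finite \<Rightarrow> real"
  assumes cont: "continuous_on UNIV g" and per: "\<And>x m. m \<in> int_lattice \<Longrightarrow> g (x + m) = g x"
    and e: "e > 0"
  obtains p where "p \<in> trig_poly" "\<And>x. cmod (of_real (g x) - p x) < e"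
proof -
  let ?Q = "cbox 0 (\<chi> i. 1) :: (real ^ 'n) set"
  define K where "K = torus_map ` ?Q"
  define G where "G z = g (SOME x. torus_map x = z)" for z
  have G: "G (torus_map x) = g x" for x
  proof -
    have "torus_map (SOME x'. torus_map x' = torus_map x) = torus_map x" by (rule someI) simp
    thus ?thesis unfolding G_def by (intro periodic_cong[OF per] torus_map_eqD)
  qed
  have onto: "torus_map x \<in> K" for x
  proof -
    obtain y where "y \<in> ?Q" "x - y \<in> int_lattice" by (rule unit_cube_representative)
    thus ?thesis using periodic_cong[of torus_map x y] torus_map_periodic by (auto simp: K_def)
  qed
  have "quotient_map (top_of_set ?Q) (top_of_set K) torus_map"
    by (rule T1_Spaces.continuous_imp_quotient_map)
      (auto simp: K_def continuous_on_torus_map compact_space_subtopology Hausdorff_space_subtopology)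
  moreover have "continuous_map (top_of_set ?Q) euclidean (G \<circ> torus_map)"
    using continuous_on_subset[OF cont subset_UNIV] by (simp add: o_def G)
  ultimately have "continuous_map (top_of_set K) euclidean G"
    by (rule continuous_compose_quotient_map)
  hence contG: "continuous_on K G" by simp
  interpret function_ring_on "{h. continuous_on K h \<and>
      (\<exists>p\<in>trig_poly. \<forall>x. of_real (h (torus_map x)) = p x)}" K
  proof (unfold_locales, goal_cases)
    case 1
    show ?case unfolding K_def by (intro compact_continuous_image continuous_on_torus_map compact_cbox)
  next
    case (3 f h)
    then obtain p q where "p \<in> trig_poly" "\<forall>x. of_real (f (torus_map x)) = p x"
      "q \<in> trig_poly" "\<forall>x. of_real (h (torus_map x)) = q x" by blast
    thus ?case using 3 by (auto intro!: continuous_intros bexI[of _ "\<lambda>x. p x + q x"] trig_poly_add)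
  next
    case (4 f h)
    then obtain p q where "p \<in> trig_poly" "\<forall>x. of_real (f (torus_map x)) = p x"
      "q \<in> trig_poly" "\<forall>x. of_real (h (torus_map x)) = q x" by blast
    thus ?case using 4 by (auto intro!: continuous_intros bexI[of _ "\<lambda>x. p x * q x"] trig_poly_mult)
  next
    case (5 c)
    show ?case by (auto intro!: trig_poly_const bexI[of _ "\<lambda>x. of_real c"])
  next
    case (6 z w)
    then obtain i where "z $ i \<noteq> w $ i" by (auto simp: vec_eq_iff)
    hence sep: "Re (z $ i) \<noteq> Re (w $ i) \<or> Im (z $ i) \<noteq> Im (w $ i)" by (simp add: complex_eq_iff)
    let ?a = "axis i 1 :: real ^ 'n"
    have cnj: "character (- ?a) x = cnj (character ?a x)" for x
      by (simp add: character_def exp_cnj)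
    have re: "of_real (Re (torus_map x $ i)) = (1/2) * character ?a x + (1/2) * character (- ?a) x" for x
      unfolding cnj by (simp add: torus_map_def complex_eq_iff)
    have im: "of_real (Im (torus_map x $ i)) = (- \<i>/2) * character ?a x + (\<i>/2) * character (- ?a) x" for x
      unfolding cnj by (simp add: torus_map_def complex_eq_iff)
    have re_in: "(\<lambda>z. Re (z $ i)) \<in> {h. continuous_on K h \<and> (\<exists>p\<in>trig_poly. \<forall>x. of_real (h (torus_map x)) = p x)}"
      by (intro CollectI conjI continuous_intros bexI[of _ "\<lambda>x. (1/2) * character ?a x + (1/2) * character (- ?a) x"] allI re
          trig_poly_add trig_poly_character int_lattice_uminus int_lattice_axis)
    have im_in: "(\<lambda>z. Im (z $ i)) \<in> {h. continuous_on K h \<and> (\<exists>p\<in>trig_poly. \<forall>x. of_real (h (torus_map x)) = p x)}"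
      by (intro CollectI conjI continuous_intros bexI[of _ "\<lambda>x. (- \<i>/2) * character ?a x + (\<i>/2) * character (- ?a) x"] allI im
          trig_poly_add trig_poly_character int_lattice_uminus int_lattice_axis)
    show ?case using sep by (elim disjE) (rule bexI[OF _ re_in], simp, rule bexI[OF _ im_in], simp)
  qed simp
  obtain h p where hp: "p \<in> trig_poly" "\<forall>x. of_real (h (torus_map x)) = p x" "\<forall>z\<in>K. \<bar>G z - h z\<bar> < e"
    using Stone_Weierstrass_basic[OF contG e] by blast
  have "cmod (of_real (g x) - p x) < e" for x
  proof -
    have "\<bar>g x - h (torus_map x)\<bar> < e" using hp(3) onto[of x] by (metis G)
    thus ?thesis using hp(2) by (metis norm_of_real of_real_diff)
  qed
  thus ?thesis using that hp(1) by blast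
qed

lemma trig_poly_dense:
  assumes f: "f \<in> test_fun" and e: "e > 0"
  obtains p where "p \<in> trig_poly" "\<And>x. cmod (f x - p x) < e"
proof -
  have per: "Re (f (x + m)) = Re (f x)" "Im (f (x + m)) = Im (f x)" if "m \<in> int_lattice" for x m
    using test_funD(1)[OF f that] by simp_all
  have "continuous_on UNIV (\<lambda>x. Re (f x))" "continuous_on UNIV (\<lambda>x. Im (f x))"
    using continuous_on_test_fun[OF f] by (auto intro: continuous_intros)
  then obtain p q where p: "p \<in> trig_poly" "\<And>x. cmod (of_real (Re (f x)) - p x) < e / 2"
    and q: "q \<in> trig_poly" "\<And>x. cmod (of_real (Im (f x)) - q x) < e / 2"
    using trig_poly_dense_real[OF _ per(1), of "e/2"] trig_poly_dense_real[OF _ per(2), of "e/2"] e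
    by (metis half_gt_zero)
  have "cmod (f x - (p x + \<i> * q x)) < e" for x
  proof -
    have "f x - (p x + \<i> * q x) = (of_real (Re (f x)) - p x) + \<i> * (of_real (Im (f x)) - q x)"
      by (subst complex_eq[of "f x"]) (simp add: algebra_simps)
    also have "cmod \<dots> \<le> cmod (of_real (Re (f x)) - p x) + cmod (\<i> * (of_real (Im (f x)) - q x))"
      by (rule norm_triangle_ineq)
    also have "\<dots> < e" using p(2)[of x] q(2)[of x] by (simp add: norm_mult)
    finally show ?thesis .
  qed
  thus ?thesis
    using that[of "\<lambda>x. p x + \<i> * q x"] p(1) q(1) trig_poly_add trig_poly_mult trig_poly_const by blast
qed

section \<open>Bounds on derivatives by a maximum principle\<close>

text \<open>The product of the operators \<open>1 - \<partial>\<^sub>i\<close> over the list. Unlike \<open>\<partial>\<^sub>i\<close> itself, each factor is injective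
  on periodic functions and does not decrease the supremum norm.\<close>

definition damped :: "'n::finite list \<Rightarrow> (real ^ 'n \<Rightarrow> complex) \<Rightarrow> real ^ 'n \<Rightarrow> complex" where
  "damped is h = foldr (\<lambda>i g. g - partial_deriv i g) is h"

lemma damped_Nil [simp]: "damped [] h = h"
  and damped_Cons [simp]: "damped (i # is) h = damped is h - partial_deriv i (damped is h)"
  by (simp_all add: damped_def)

lemma damped_append: "damped (is @ js) h = damped is (damped js h)"
  by (simp add: damped_def)

lemma damped_in_test_fun: "h \<in> test_fun \<Longrightarrow> damped is h \<in> test_fun"
  by (induction "is") (auto intro: test_fun_diff partial_deriv_in_test_fun)

lemma partial_deriv_diff:
  "f \<in> test_fun \<Longrightarrow> g \<in> test_fun \<Longrightarrow> partial_deriv i (f - g) = partial_deriv i f - partial_deriv i g"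
  using iter_deriv_diff[of f g "[i]"] by simp

lemma partial_deriv_damped:
  "h \<in> test_fun \<Longrightarrow> partial_deriv i (damped is h) = damped is (partial_deriv i h)"
  by (induction "is")
    (simp_all add: partial_deriv_diff damped_in_test_fun partial_deriv_in_test_fun partial_deriv_commute[of _ i])

lemma damped_diff:
  "f \<in> test_fun \<Longrightarrow> g \<in> test_fun \<Longrightarrow> damped is (f - g) = damped is f - damped is g"
  by (induction "is") (simp_all add: partial_deriv_diff damped_in_test_fun)

lemma damped_Cons_right: "h \<in> test_fun \<Longrightarrow> damped (i # is) h = damped is (h - partial_deriv i h)"
  by (simp add: damped_diff partial_deriv_damped partial_deriv_in_test_fun)

lemma damped_commute: "h \<in> test_fun \<Longrightarrow> damped is (damped js h) = damped js (damped is h)"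
  by (induction js arbitrary: h)
    (simp_all add: damped_in_test_fun partial_deriv_in_test_fun damped_diff flip: partial_deriv_damped)

lemma test_fun_attains_max:
  assumes h: "h \<in> test_fun"
  obtains z where "\<And>x. cmod (h x) \<le> cmod (h z)"
proof -
  let ?Q = "cbox 0 (\<chi> i. 1) :: (real ^ 'a) set"
  have "continuous_on ?Q (\<lambda>x. cmod (h x))"
    by (intro continuous_intros continuous_on_test_fun[OF h])
  moreover have "?Q \<noteq> {}" by (metis unit_cube_representative empty_iff)
  ultimately have "\<exists>z\<in>?Q. \<forall>y\<in>?Q. cmod (h y) \<le> cmod (h z)"
    by (intro continuous_attains_sup compact_cbox)
  then obtain z where z: "\<And>y. y \<in> ?Q \<Longrightarrow> cmod (h y) \<le> cmod (h z)" by blast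
  have "cmod (h x) \<le> cmod (h z)" for x
  proof -
    obtain y where "y \<in> ?Q" "x - y \<in> int_lattice" by (rule unit_cube_representative)
    thus ?thesis using z[of y] periodic_cong[of h x y] test_funD(1)[OF h] by auto
  qed
  thus ?thesis by (rule that)
qed

text \<open>At a point \<open>z\<close> where \<open>\<bar>h\<bar>\<close> is maximal, the real function \<open>t \<mapsto> h z \<bullet> h (z + t e\<^sub>i)\<close> is maximal at \<open>t = 0\<close>,
  by the Cauchy-Schwarz inequality. So \<open>\<partial>\<^sub>i h z\<close> is orthogonal to \<open>h z\<close> in the plane, and subtracting it
  cannot shorten \<open>h z\<close>.\<close>

lemma damped_max_principle:
  assumes h: "h \<in> test_fun" and B: "\<And>x. cmod (h x - partial_deriv i h x) \<le> B"
  shows "cmod (h x) \<le> B"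
proof -
  obtain z where z: "\<And>x. cmod (h x) \<le> cmod (h z)" by (rule test_fun_attains_max[OF h]) blast
  have "((\<lambda>t. h (z + t *\<^sub>R axis i 1)) has_vector_derivative partial_deriv i h z) (at 0)"
    using has_vector_derivative_partial_deriv[of h z 0 i] test_funD(3)[OF h] by simp
  from bounded_linear.has_vector_derivative[OF bounded_linear_inner_right this, of "h z"]
  have deriv: "((\<lambda>t. h z \<bullet> h (z + t *\<^sub>R axis i 1)) has_real_derivative h z \<bullet> partial_deriv i h z) (at 0)"
    by (simp add: has_real_derivative_iff_has_vector_derivative)
  have "h z \<bullet> h (z + t *\<^sub>R axis i 1) \<le> h z \<bullet> h (z + 0 *\<^sub>R axis i 1)" for t
  proof -
    have "h z \<bullet> h (z + t *\<^sub>R axis i 1) \<le> cmod (h z) * cmod (h (z + t *\<^sub>R axis i 1))"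
      by (rule norm_cauchy_schwarz)
    also have "\<dots> \<le> cmod (h z) * cmod (h z)" by (intro mult_left_mono z) simp
    finally show ?thesis by (simp add: dot_square_norm power2_eq_square)
  qed
  hence critical: "h z \<bullet> partial_deriv i h z = 0"
    by (intro DERIV_local_max[OF deriv, of 1]) auto
  have "cmod (h z) * cmod (h z) = h z \<bullet> (h z - partial_deriv i h z)"
    by (simp add: inner_diff_right critical dot_square_norm power2_eq_square)
  also have "\<dots> \<le> cmod (h z) * cmod (h z - partial_deriv i h z)" by (rule norm_cauchy_schwarz)
  also have "\<dots> \<le> cmod (h z) * B" by (intro mult_left_mono B) simp
  finally have "cmod (h z) \<le> B \<or> cmod (h z) = 0" by (auto simp: mult_le_cancel_left)
  moreover have "0 \<le> B" using B[of z] norm_ge_zero order_trans by blast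
  ultimately show ?thesis using z[of x] by linarith
qed

lemma bound_damped:
  assumes "h \<in> test_fun" "\<And>x. cmod (damped is h x) \<le> B"
  shows "cmod (h x) \<le> B"
  using assms(2)
proof (induction "is" arbitrary: x)
  case (Cons i "is")
  have "cmod (damped is h x) \<le> B" for x
    by (rule damped_max_principle[OF damped_in_test_fun[OF assms(1)]]) (use Cons.prems in simp)
  thus ?case by (rule Cons.IH)
qed simp

text \<open>Each derivative costs a factor 2, because \<open>\<partial>\<^sub>i g = g - (g - \<partial>\<^sub>i g)\<close> and both terms are bounded by
  the supremum of \<open>\<bar>g - \<partial>\<^sub>i g\<bar>\<close>.\<close>

lemma bound_iter_deriv:
  assumes "h \<in> test_fun" "\<And>x. cmod (damped is h x) \<le> B"
  shows "cmod (iter_deriv is h x) \<le> 2 ^ length is * B"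
  using assms
proof (induction "is" arbitrary: h B x)
  case (Cons i "is")
  let ?g = "h - partial_deriv i h"
  have g: "?g \<in> test_fun" using Cons.prems(1) by (intro test_fun_diff partial_deriv_in_test_fun)
  have ig: "iter_deriv is ?g = iter_deriv is h - partial_deriv i (iter_deriv is h)"
  proof -
    have "iter_deriv is (partial_deriv i h) = partial_deriv i (iter_deriv is h)"
      using Cons.prems(1)
      by (induction "is") (simp_all add: partial_deriv_commute[of _ i] iter_deriv_in_test_fun)
    thus ?thesis using Cons.prems(1) by (simp add: iter_deriv_diff partial_deriv_in_test_fun)
  qed
  have bound: "cmod (iter_deriv is h x - partial_deriv i (iter_deriv is h) x) \<le> 2 ^ length is * B" for x
  proof -
    have "cmod (iter_deriv is ?g x) \<le> 2 ^ length is * B"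
      by (rule Cons.IH[OF g]) (use Cons.prems in \<open>simp only: damped_Cons_right\<close>)
    thus ?thesis by (simp add: ig)
  qed
  have "cmod (iter_deriv is h x) \<le> 2 ^ length is * B"
    by (rule damped_max_principle[OF iter_deriv_in_test_fun[OF Cons.prems(1)] bound])
  thus ?case
    using bound[of x] norm_triangle_ineq4[of "iter_deriv is h x" "iter_deriv is h x - partial_deriv i (iter_deriv is h) x"]
    by simp
qed simp

text \<open>Concatenating the lists in \<open>S\<close> works: the operators commute, so the factors beyond those that
  belong to a given list can be removed by the maximum principle.\<close>

lemma bound_finitely_many_derivs:
  fixes S :: "'n::finite list set"
  assumes "finite S"
  obtains js :: "'n list" and C where "C > 0"
    "\<And>h B is x. h \<in> test_fun \<Longrightarrow> (\<And>x. cmod (damped js h x) \<le> B) \<Longrightarrow> is \<in> S \<Longrightarrow>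
      cmod (iter_deriv is h x) \<le> C * B"
proof -
  have "\<exists>js C. C > 0 \<and> (\<forall>h\<in>test_fun. \<forall>B. (\<forall>x. cmod (damped js h x) \<le> B) \<longrightarrow>
      (\<forall>is\<in>S. \<forall>x. cmod (iter_deriv is h x) \<le> C * B))"
    using assms
  proof (induction S)
    case empty
    show ?case by (auto intro: exI[of _ 1])
  next
    case (insert l S)
    then obtain js C where C: "C > 0" and IH: "\<And>h B is x. h \<in> test_fun \<Longrightarrow>
        (\<And>x. cmod (damped js h x) \<le> B) \<Longrightarrow> is \<in> S \<Longrightarrow> cmod (iter_deriv is h x) \<le> C * B" by blast
    have "cmod (iter_deriv is h x) \<le> (C + 2 ^ length l) * B"
      if h: "h \<in> test_fun" and B: "\<And>x. cmod (damped (l @ js) h x) \<le> B" and l: "is \<in> insert l S" for h B "is" x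
    proof -
      have B0: "0 \<le> B" using B[of x] norm_ge_zero order_trans by blast
      have "cmod (damped js h x) \<le> B" for x
        by (rule bound_damped[OF damped_in_test_fun[OF h], of l])
          (use B in \<open>simp add: damped_append\<close>)
      hence "cmod (iter_deriv is h x) \<le> C * B" if "is \<in> S" using IH[OF h _ that] by blast
      moreover have "cmod (damped l h x) \<le> B" for x
        by (rule bound_damped[OF damped_in_test_fun[OF h], of js])
          (use B in \<open>simp add: damped_append damped_commute[OF h, of js]\<close>)
      hence "cmod (iter_deriv l h x) \<le> 2 ^ length l * B" by (rule bound_iter_deriv[OF h])
      moreover have "0 \<le> C * B" "0 \<le> 2 ^ length l * B" using B0 C by auto
      ultimately show ?thesis using l by (auto simp: distrib_right)
    qed
    moreover have "C + 2 ^ length l > 0" using C by (simp add: add_pos_pos)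
    ultimately show ?case by blast
  qed
  thus ?thesis using that by blast
qed

text \<open>Dividing each coefficient by \<open>1 - 2\<pi>\<i> k\<^sub>i\<close>, whose real part is 1, inverts \<open>1 - \<partial>\<^sub>i\<close>.\<close>

lemma damped_trig_poly_surj:
  assumes "p \<in> trig_poly"
  obtains q where "q \<in> trig_poly" "damped is q = p"
proof -
  have step: "\<exists>q\<in>trig_poly. q - partial_deriv i q = p" if "p \<in> trig_poly" for p i
    using that
  proof (induction rule: trig_poly.induct)
    case zero
    have "partial_deriv i (\<lambda>x. 0) = (\<lambda>x. 0)"
      using iter_deriv_scale[OF character_in_test_fun[OF int_lattice_0], of "[i]" 0] by simp
    thus ?case using trig_poly.zero by (intro bexI[of _ "\<lambda>x. 0"]) (auto simp: fun_eq_iff)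
  next
    case (add_character p k c)
    then obtain q where q: "q \<in> trig_poly" "q - partial_deriv i q = p" by blast
    let ?e = "1 - 2 * of_real pi * \<i> * of_real (k $ i)"
    have ne: "?e \<noteq> 0" by (simp add: complex_eq_iff)
    define b where "b = c / ?e"
    have b: "c = b * ?e" using ne by (simp add: b_def)
    let ?q = "\<lambda>x. b * character k x + q x"
    have "partial_deriv i ?q x = b * partial_deriv i (character k) x + partial_deriv i q x" for x
      using partial_deriv_lincomb[OF differentiable_character test_funD(3)[OF trig_poly_in_test_fun[OF q(1)]],
          of i b k 1 x] by simp
    hence "?q x - partial_deriv i ?q x = b * ?e * character k x + (q - partial_deriv i q) x" for x
      by (simp add: partial_deriv_character algebra_simps)
    hence "?q - partial_deriv i ?q = (\<lambda>x. c * character k x + p x)"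
      unfolding b using q(2) by (simp add: fun_eq_iff)
    thus ?case using trig_poly.add_character[OF q(1) add_character.hyps(2)] by blast
  qed
  have "\<exists>q\<in>trig_poly. damped is q = p"
    using assms
  proof (induction "is" arbitrary: p)
    case (Cons i "is")
    then obtain g where "g \<in> trig_poly" "g - partial_deriv i g = p" using step by blast
    thus ?case using Cons.IH[of g] by auto
  qed auto
  thus ?thesis using that by blast
qed

section \<open>Distributions are determined by their Fourier coefficients\<close>

lemma iter_deriv_le_seminorm:
  assumes "f \<in> test_fun"
  shows "cmod (iter_deriv is f x) \<le> test_seminorm is f"
proof -
  obtain z where "\<And>x. cmod (iter_deriv is f x) \<le> cmod (iter_deriv is f z)"
    using test_fun_attains_max[OF iter_deriv_in_test_fun[OF assms]] by blast
  hence "bdd_above (range (\<lambda>x. cmod (iter_deriv is f x)))" by (rule bdd_aboveI2)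
  thus ?thesis unfolding test_seminorm_def by (intro cSUP_upper) auto
qed

lemma seminorm_le: "(\<And>x. cmod (iter_deriv is f x) \<le> B) \<Longrightarrow> test_seminorm is f \<le> B"
  unfolding test_seminorm_def by (intro cSUP_least) auto

lemma seminorm_triangle:
  assumes "f \<in> test_fun" "g \<in> test_fun" "h \<in> test_fun"
  shows "test_seminorm is (h - f) \<le> test_seminorm is (h - g) + test_seminorm is (g - f)"
proof (rule seminorm_le)
  fix x
  have "iter_deriv is (h - f) x = iter_deriv is (h - g) x + iter_deriv is (g - f) x"
    using assms by (simp add: iter_deriv_diff)
  thus "cmod (iter_deriv is (h - f) x) \<le> test_seminorm is (h - g) + test_seminorm is (g - f)"
    using norm_triangle_ineq[of "iter_deriv is (h - g) x" "iter_deriv is (g - f) x"]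
      iter_deriv_le_seminorm[OF test_fun_diff[OF assms(3,2)], of "is" x]
      iter_deriv_le_seminorm[OF test_fun_diff[OF assms(2,1)], of "is" x] by simp
qed

text \<open>The subbasic sets are balls around arbitrary centres; the triangle inequality provides a
  ball around \<open>\<phi>\<close> inside each of them.\<close>

lemma seminorm_neighbourhood:
  assumes "openin test_topology U" "\<phi> \<in> U"
  obtains S e where "finite S" "e > 0" "\<phi> \<in> test_fun"
    "\<And>g. g \<in> test_fun \<Longrightarrow> (\<And>is. is \<in> S \<Longrightarrow> test_seminorm is (g - \<phi>) < e) \<Longrightarrow> g \<in> U"
proof -
  let ?B = "{{g \<in> test_fun. test_seminorm is (g - f) < \<epsilon>} | is f \<epsilon>. f \<in> test_fun \<and> 0 < \<epsilon>}"
  have "generate_topology_on ?B U"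
    using assms(1) unfolding test_topology_def openin_topology_generated_by_iff .
  hence "\<exists>S e. finite S \<and> e > 0 \<and> \<phi> \<in> test_fun \<and>
      (\<forall>g\<in>test_fun. (\<forall>is\<in>S. test_seminorm is (g - \<phi>) < e) \<longrightarrow> g \<in> U)"
    using assms(2)
  proof (induction rule: generate_topology_on.induct)
    case (Int a b)
    then obtain S e T e' where 1: "finite S" "e > 0" "\<phi> \<in> test_fun"
        "\<forall>g\<in>test_fun. (\<forall>is\<in>S. test_seminorm is (g - \<phi>) < e) \<longrightarrow> g \<in> a"
      and 2: "finite T" "e' > 0"
        "\<forall>g\<in>test_fun. (\<forall>is\<in>T. test_seminorm is (g - \<phi>) < e') \<longrightarrow> g \<in> b" by blast
    have "finite (S \<union> T)" "min e e' > 0" using 1 2 by auto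
    moreover have "\<forall>g\<in>test_fun. (\<forall>is\<in>S \<union> T. test_seminorm is (g - \<phi>) < min e e') \<longrightarrow> g \<in> a \<inter> b"
      using 1(4) 2(3) by auto
    ultimately show ?case using 1(3) by blast
  next
    case (UN K)
    then obtain k where k: "k \<in> K" "\<phi> \<in> k" by blast
    from UN.IH[OF this] obtain S e where "finite S" "e > 0" "\<phi> \<in> test_fun"
        "\<forall>g\<in>test_fun. (\<forall>is\<in>S. test_seminorm is (g - \<phi>) < e) \<longrightarrow> g \<in> k" by blast
    thus ?case using k(1) by blast
  next
    case (Basis s)
    then obtain "is" f \<epsilon> where s: "s = {g \<in> test_fun. test_seminorm is (g - f) < \<epsilon>}" "f \<in> test_fun"
      by blast
    let ?e = "\<epsilon> - test_seminorm is (\<phi> - f)"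
    have \<phi>: "\<phi> \<in> test_fun" "?e > 0" using Basis s by auto
    have "g \<in> s" if "g \<in> test_fun" "test_seminorm is (g - \<phi>) < ?e" for g
    proof -
      have "test_seminorm is (g - f) < \<epsilon>"
        using seminorm_triangle[OF s(2) \<phi>(1) that(1), of "is"] that(2) by linarith
      thus ?thesis using that(1) s(1) by blast
    qed
    hence "\<forall>g\<in>test_fun. (\<forall>is'\<in>{is}. test_seminorm is' (g - \<phi>) < ?e) \<longrightarrow> g \<in> s" by blast
    with \<phi> show ?case by (intro exI[of _ "{is}"] exI[of _ ?e] conjI) (simp, blast+)
  qed simp
  thus ?thesis using that by metis
qed

text \<open>Uniform approximation of \<open>damped js \<phi>\<close> for one suitable list \<open>js\<close> is enough, since the damped
  operator can be undone on trigonometric polynomials and bounds the required derivatives.\<close>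

lemma trig_poly_dense_seminorms:
  assumes \<phi>: "\<phi> \<in> test_fun" and S: "finite S" and e: "e > 0"
  obtains p where "p \<in> trig_poly" "\<And>is. is \<in> S \<Longrightarrow> test_seminorm is (p - \<phi>) < e"
proof -
  obtain js C where C: "C > 0" and bound: "\<And>h B is x. h \<in> test_fun \<Longrightarrow>
      (\<And>x. cmod (damped js h x) \<le> B) \<Longrightarrow> is \<in> S \<Longrightarrow> cmod (iter_deriv is h x) \<le> C * B"
    by (rule bound_finitely_many_derivs[OF S]) blast
  obtain q where q: "q \<in> trig_poly" "\<And>x. cmod (damped js \<phi> x - q x) < e / (2 * C)"
    using trig_poly_dense[OF damped_in_test_fun[OF \<phi>], of "e / (2 * C)" js] C e by auto
  obtain p where p: "p \<in> trig_poly" "damped js p = q" by (rule damped_trig_poly_surj[OF q(1)])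
  have "cmod (damped js (p - \<phi>) x) \<le> e / (2 * C)" for x
    using q(2)[of x] by (simp add: damped_diff[OF trig_poly_in_test_fun[OF p(1)] \<phi>] p(2) norm_minus_commute)
  hence "cmod (iter_deriv is (p - \<phi>) x) \<le> C * (e / (2 * C))" if "is \<in> S" for "is" x
    using bound[OF test_fun_diff[OF trig_poly_in_test_fun[OF p(1)] \<phi>] _ that] by blast
  hence "test_seminorm is (p - \<phi>) \<le> C * (e / (2 * C))" if "is \<in> S" for "is"
    using that by (intro seminorm_le) 
  moreover have "C * (e / (2 * C)) < e" using C e by simp
  ultimately show ?thesis using that p(1) by fastforce
qed

lemma distributionsD:
  assumes "u \<in> distributions"
  shows "\<phi> \<in> test_fun \<Longrightarrow> \<psi> \<in> test_fun \<Longrightarrow> u (\<phi> + \<psi>) = u \<phi> + u \<psi>"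
    "\<phi> \<in> test_fun \<Longrightarrow> u (\<lambda>x. c * \<phi> x) = c * u \<phi>"
    "continuous_map test_topology euclidean u" "\<phi> \<notin> test_fun \<Longrightarrow> u \<phi> = 0"
  using assms by (auto simp: distributions_def)

lemma distribution_zero: "u \<in> distributions \<Longrightarrow> u (\<lambda>x. 0) = 0"
  using distributionsD(2)[of u "character 0" 0] character_in_test_fun[OF int_lattice_0] by simp

lemma distribution_eq_0I:
  assumes u: "u \<in> distributions" and coeff: "\<And>k. k \<in> int_lattice \<Longrightarrow> fourier_coeff u k = 0"
  shows "u = 0"
proof
  fix \<phi>
  have trig: "u p = 0" if "p \<in> trig_poly" for p
    using that
  proof (induction rule: trig_poly.induct)
    case zero
    show ?case by (rule distribution_zero[OF u])
  next
    case (add_character p k c)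
    have k: "character k \<in> test_fun" by (rule character_in_test_fun) fact
    have "u (character k) = 0"
      using coeff[OF int_lattice_uminus[OF add_character.hyps(2)]] by (simp add: fourier_coeff_def)
    moreover have "(\<lambda>x. c * character k x + p x) = (\<lambda>x. c * character k x) + p" by auto
    ultimately show ?case
      using add_character.IH distributionsD(1)[OF u test_fun_scale[OF k] trig_poly_in_test_fun[OF add_character.hyps(1)]]
        distributionsD(2)[OF u k] by simp
  qed
  show "u \<phi> = 0 \<phi>"
  proof (rule ccontr)
    assume "u \<phi> \<noteq> 0 \<phi>"
    hence ne: "u \<phi> \<noteq> 0" by simp
    hence \<phi>: "\<phi> \<in> test_fun" using distributionsD(4)[OF u] by blast
    let ?U = "{g \<in> topspace test_topology. u g \<in> - {0}}"
    have "openin euclidean (- {0 :: complex})" by (simp add: open_Compl)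
    hence openU: "openin test_topology ?U"
      by (rule openin_continuous_map_preimage[OF distributionsD(3)[OF u]])
    have "\<phi> \<in> topspace test_topology"
      unfolding test_topology_def topology_generated_by_topspace
    proof (rule UnionI)
      show "{g \<in> test_fun. test_seminorm [] (g - \<phi>) < 1} \<in>
          {{g \<in> test_fun. test_seminorm is (g - f) < \<epsilon>} | is f \<epsilon>. f \<in> test_fun \<and> 0 < \<epsilon>}"
        using \<phi> zero_less_one[where 'a = real] by blast
      show "\<phi> \<in> {g \<in> test_fun. test_seminorm [] (g - \<phi>) < 1}"
        using \<phi> seminorm_le[of "[]" "\<phi> - \<phi>" 0] by simp
    qed
    hence inU: "\<phi> \<in> ?U" using ne by simp
    obtain S e where S: "finite S" "e > 0"
        "\<And>g. g \<in> test_fun \<Longrightarrow> (\<And>is. is \<in> S \<Longrightarrow> test_seminorm is (g - \<phi>) < e) \<Longrightarrow> g \<in> ?U"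
      by (rule seminorm_neighbourhood[OF openU inU]) blast
    obtain p where p: "p \<in> trig_poly" "\<And>is. is \<in> S \<Longrightarrow> test_seminorm is (p - \<phi>) < e"
      by (rule trig_poly_dense_seminorms[OF \<phi> S(1,2)]) blast
    have "p \<in> ?U" by (rule S(3)[OF trig_poly_in_test_fun[OF p(1)] p(2)])
    thus False using trig[OF p(1)] by simp
  qed
qed

section \<open>Fourier coefficients of the Radon transform\<close>

lemma integral_character_segment:
  assumes m: "m \<in> \<int>"
  shows "set_integrable lborel {0..1} (\<lambda>t. exp (2 * of_real pi * \<i> * of_real (t * m)))"
    and "(LINT t:{0..1}|lborel. exp (2 * of_real pi * \<i> * of_real (t * m))) = (if m = 0 then 1 else 0)"
proof -
  let ?f = "\<lambda>t. exp (2 * of_real pi * \<i> * of_real (t * m))"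
  show int: "set_integrable lborel {0..1} ?f"
    by (intro borel_integrable_atLeastAtMost' continuous_intros)
  show "(LINT t:{0..1}|lborel. ?f t) = (if m = 0 then 1 else 0)"
  proof (cases "m = 0")
    case True
    have "integral {0..1} ?f = 1" using True by simp
    thus ?thesis using set_borel_integral_eq_integral(2)[OF int] True by simp
  next
    case False
    let ?c = "2 * of_real pi * \<i> * of_real m"
    have c: "?c \<noteq> 0" using False by simp
    have "((\<lambda>t. exp (?c * of_real t) / ?c) has_vector_derivative ?f t) (at t within {0..1})" for t
      using c by (auto intro!: derivative_eq_intros has_vector_derivative_real_field simp: mult_ac)
    hence "(?f has_integral (exp (?c * of_real 1) / ?c - exp (?c * of_real 0) / ?c)) {0..1}"
      by (intro fundamental_theorem_of_calculus) auto
    hence "(?f has_integral 0) {0..1}" using exp_2pi_i_int[OF m] by simp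
    thus ?thesis using set_borel_integral_eq_integral(2)[OF int] False by (simp add: integral_unique)
  qed
qed

lemma character_sum: "finite A \<Longrightarrow> character k (\<Sum>v\<in>A. f v) = (\<Prod>v\<in>A. character k (f v))"
proof (induction A rule: finite_induct)
  case empty
  show ?case by (simp add: character_def)
qed (simp add: character_add)

lemma radon_test_character:
  assumes k: "k \<in> int_lattice" and A: "finite A" "A \<subseteq> int_lattice"
  shows "radon_test (character k) A =
    (if \<forall>v\<in>A. k \<bullet> v = 0 then character k else (\<lambda>x. 0))"
proof
  fix x
  let ?g = "\<lambda>v t. indicator {0..1} t *\<^sub>R exp (2 * of_real pi * \<i> * of_real (t * (k \<bullet> v))) :: complex"
  interpret product_sigma_finite "\<lambda>_::real ^ 'a. lborel :: real measure" ..
  have kv: "k \<bullet> v \<in> \<int>" if "v \<in> A" for v using inner_int_lattice[OF k] A(2) that by blast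
  have ind: "indicator (Pi\<^sub>E A (\<lambda>_. {0..1})) t = (\<Prod>v\<in>A. indicator {0..1} (t v) :: real)"
    if "t \<in> space (Pi\<^sub>M A (\<lambda>_. lborel))" for t :: "real ^ 'a \<Rightarrow> real"
    using that A(1) by (auto simp: indicator_def space_PiM PiE_iff prod_zero_iff)
  have "radon_test (character k) A x = (\<integral>t. character k x * (\<Prod>v\<in>A. ?g v (t v)) \<partial>Pi\<^sub>M A (\<lambda>_. lborel))"
    unfolding radon_test_def set_lebesgue_integral_def
  proof (rule Bochner_Integration.integral_cong[OF refl])
    fix t assume t: "t \<in> space (Pi\<^sub>M A (\<lambda>_. lborel :: real measure))"
    have "character k (t v *\<^sub>R v) = exp (2 * of_real pi * \<i> * of_real (t v * (k \<bullet> v)))" for v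
      by (simp add: character_def)
    thus "indicator (Pi\<^sub>E A (\<lambda>_. {0..1})) t *\<^sub>R character k (x + (\<Sum>v\<in>A. t v *\<^sub>R v)) =
        character k x * (\<Prod>v\<in>A. ?g v (t v))"
      by (simp only: character_add character_sum[OF A(1)] ind[OF t] scaleR_conv_of_real of_real_prod
          prod.distrib mult_ac)
  qed
  also have "\<dots> = character k x * (\<Prod>v\<in>A. integral\<^sup>L lborel (?g v))"
    using product_integral_prod[of A ?g, OF A(1)] integral_character_segment(1)[OF kv]
    by (simp only: integral_mult_right_zero set_integrable_def)
  also have "(\<Prod>v\<in>A. integral\<^sup>L lborel (?g v)) = (\<Prod>v\<in>A. if k \<bullet> v = 0 then 1 else 0)"
    using integral_character_segment(2)[OF kv] by (intro prod.cong) (auto simp: set_lebesgue_integral_def)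
  also have "\<dots> = (if \<forall>v\<in>A. k \<bullet> v = 0 then 1 else 0)"
    using A(1) by (auto intro!: prod.neutral)
  finally show "radon_test (character k) A x =
      (if \<forall>v\<in>A. k \<bullet> v = 0 then character k else (\<lambda>x. 0)) x" by simp
qed

lemma fourier_coeff_radon:
  assumes u: "u \<in> distributions" and A: "A \<in> direction_sets d" and k: "k \<in> int_lattice"
  shows "fourier_coeff (radon d u A) k = (if \<forall>v\<in>A. k \<bullet> v = 0 then fourier_coeff u k else 0)"
proof -
  have "finite A" "A \<subseteq> int_lattice" using A by (auto simp: direction_sets_def)
  from radon_test_character[OF int_lattice_uminus[OF k] this]
  show ?thesis
    using A character_in_test_fun[OF int_lattice_uminus[OF k]] distribution_zero[OF u]
    by (auto simp: fourier_coeff_def radon_def)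
qed

text \<open>If \<open>l\<close> is a lattice vector with \<open>l\<^sub>j \<noteq> 0\<close>, the \<open>n - 1\<close> vectors \<open>l\<^sub>j e\<^sub>i - l\<^sub>i e\<^sub>j\<close> with \<open>i \<noteq> j\<close> are
  orthogonal to \<open>l\<close>. They are independent because the \<open>i\<close>-th one is, up to the \<open>j\<close>-th
  coordinate, the multiple \<open>l\<^sub>j e\<^sub>i\<close> of a unit vector.\<close>

lemma exists_orthogonal_direction_set:
  fixes k :: "real ^ 'n::finite"
  assumes k: "k \<in> int_lattice" and d: "d < CARD('n)"
  obtains A where "A \<in> direction_sets d" "\<forall>v\<in>A. k \<bullet> v = 0"
proof -
  \<comment> \<open>Every vector is orthogonal to \<open>k = 0\<close>, so any nonzero \<open>l\<close> serves in that case.\<close>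
  obtain l :: "real ^ 'n" and j where l: "l \<in> int_lattice" "l $ j \<noteq> 0" "k = 0 \<or> k = l"
  proof (cases "k = 0")
    case True
    thus ?thesis by (intro that[of "axis undefined 1" undefined] int_lattice_axis) simp_all
  next
    case False
    then obtain j where "k $ j \<noteq> 0" by (auto simp: vec_eq_iff)
    thus ?thesis using that k by blast
  qed
  define w where "w i = l $ j *\<^sub>R axis i 1 - l $ i *\<^sub>R axis j (1::real)" for i
  have w_comp: "w i $ h = (if h = i then l $ j else 0)" if "h \<noteq> j" for i h
    using that by (simp add: w_def axis_def)
  have inj: "inj_on w (- {j})"
  proof (rule inj_onI)
    fix a b assume "a \<in> - {j}" "b \<in> - {j}" "w a = w b"
    thus "a = b" using w_comp[of a a] w_comp[of a b] l(2) by (auto split: if_splits)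
  qed
  have "d \<le> card (- {j})" using d by (simp add: Compl_eq_Diff_UNIV card_Diff_singleton)
  then obtain I where I: "I \<subseteq> - {j}" "card I = d" by (meson obtain_subset_with_card_n)
  have finI: "finite I" by simp
  have injI: "inj_on w I" using inj I(1) by (rule inj_on_subset)
  have indep: "independent (w ` I)"
  proof (rule independent_if_scalars_zero)
    fix f v assume sum: "(\<Sum>x\<in>w ` I. f x *\<^sub>R x) = 0" and "v \<in> w ` I"
    then obtain i where i: "i \<in> I" "v = w i" by blast
    have ij: "i \<noteq> j" using i I(1) by auto
    have "0 = (\<Sum>a\<in>I. f (w a) *\<^sub>R w a) $ i" using sum by (simp add: sum.reindex[OF injI])
    also have "\<dots> = (\<Sum>a\<in>I. if a = i then f (w i) * l $ j else 0)"
      by (simp only: sum_component vector_scaleR_component w_comp[OF ij]) (rule sum.cong, auto)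
    also have "\<dots> = f (w i) * l $ j" using i by simp
    finally show "f v = 0" using l(2) i by simp
  qed (use finI in simp)
  have lat: "w i \<in> int_lattice" for i
    using l(1) by (auto simp: int_lattice_def w_def axis_def)
  have orth: "k \<bullet> w i = 0" for i
    using l(3) by (auto simp: w_def inner_diff_right inner_axis mult.commute)
  have "w ` I \<in> direction_sets d"
    using indep lat finI I(2) dependent_zero[of "w ` I"]
    by (auto simp: direction_sets_def card_image[OF injI])
  thus ?thesis using that orth by blast
qed

text \<open>The function \<open>\<Phi>\<close> stands for the modulus in the maximum formula and for its square in the norm of
  the image.\<close>

lemma fourier_coeff_radon_max:
  fixes u :: "(real ^ 'n::finite \<Rightarrow> complex) \<Rightarrow> complex"
  assumes u: "u \<in> distributions" and k: "k \<in> int_lattice" and d: "d < CARD('n)"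
    and \<Phi>: "\<And>z. \<Phi> 0 \<le> \<Phi> z"
  shows "is_max_over (\<Phi> (fourier_coeff u k)) (\<lambda>A. \<Phi> (fourier_coeff (radon d u A) k)) (direction_sets d)"
proof -
  obtain A where A: "A \<in> direction_sets d" "\<forall>v\<in>A. k \<bullet> v = 0"
    by (rule exists_orthogonal_direction_set[OF k d])
  thus ?thesis
    using fourier_coeff_radon[OF u _ k] \<Phi> unfolding is_max_over_def
    by (intro conjI image_eqI[of _ _ A]) auto
qed

lemma radon_term_radon:
  fixes u :: "(real ^ 'n::finite \<Rightarrow> complex) \<Rightarrow> complex"
  assumes "u \<in> distributions" "k \<in> int_lattice" "d < CARD('n)"
  shows "radon_term d s (radon d u) k = sobolev_term s u k"
proof -
  have "is_max_over ((cmod (fourier_coeff u k))\<^sup>2)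
      (\<lambda>A. (cmod (fourier_coeff (radon d u A) k))\<^sup>2) (direction_sets d)"
    using fourier_coeff_radon_max[OF assms, of "\<lambda>z. (cmod z)\<^sup>2"] by simp
  hence "max_over (\<lambda>A. (cmod (fourier_coeff (radon d u A) k))\<^sup>2) (direction_sets d) =
      (cmod (fourier_coeff u k))\<^sup>2"
    unfolding max_over_def is_max_over_def by (intro the_equality) (auto intro: antisym)
  thus ?thesis by (simp add: radon_term_def sobolev_term_def)
qed

section \<open>Sobolev norms and the isometry\<close>

text \<open>Minkowski's inequality on finite subsets bounds all partial sums, which gives both the
  summability and the inequality for the infinite sums.\<close>

lemma sqrt_infsum_squares_triangle:
  fixes f g h :: "'a \<Rightarrow> real"
  assumes f: "(\<lambda>x. (f x)\<^sup>2) summable_on A" and g: "(\<lambda>x. (g x)\<^sup>2) summable_on A"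
    and h: "\<And>x. x \<in> A \<Longrightarrow> 0 \<le> h x \<and> h x \<le> f x + g x"
  shows "(\<lambda>x. (h x)\<^sup>2) summable_on A"
    and "sqrt (\<Sum>\<^sub>\<infinity>x\<in>A. (h x)\<^sup>2) \<le> sqrt (\<Sum>\<^sub>\<infinity>x\<in>A. (f x)\<^sup>2) + sqrt (\<Sum>\<^sub>\<infinity>x\<in>A. (g x)\<^sup>2)"
proof -
  let ?b = "sqrt (\<Sum>\<^sub>\<infinity>x\<in>A. (f x)\<^sup>2) + sqrt (\<Sum>\<^sub>\<infinity>x\<in>A. (g x)\<^sup>2)"
  have fin: "(\<Sum>x\<in>F. (h x)\<^sup>2) \<le> ?b\<^sup>2" if F: "finite F" "F \<subseteq> A" for F
  proof -
    have "sqrt (\<Sum>x\<in>F. (h x)\<^sup>2) \<le> L2_set (\<lambda>x. f x + g x) F"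
      using h F(2) unfolding L2_set_def by (intro real_sqrt_le_mono sum_mono power_mono) auto
    also have "\<dots> \<le> L2_set f F + L2_set g F" by (rule L2_set_triangle_ineq)
    also have "\<dots> \<le> ?b"
      unfolding L2_set_def using f g F
      by (intro add_mono real_sqrt_le_mono finite_sum_le_infsum) auto
    finally show ?thesis by (rule sqrt_le_D)
  qed
  show sm: "(\<lambda>x. (h x)\<^sup>2) summable_on A"
    using fin by (intro nonneg_bdd_above_summable_on) (auto intro!: bdd_aboveI2)
  have "0 \<le> ?b" by (intro add_nonneg_nonneg real_sqrt_ge_zero infsum_nonneg) auto
  thus "sqrt (\<Sum>\<^sub>\<infinity>x\<in>A. (h x)\<^sup>2) \<le> ?b"
    using infsum_le_finite_sums[OF sm fin] by (intro real_le_lsqrt) auto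
qed

lemma fourier_coeff_add: "fourier_coeff (u + v) k = fourier_coeff u k + fourier_coeff v k"
  and fourier_coeff_scale: "fourier_coeff (dist_scale c u) k = c * fourier_coeff u k"
  by (simp_all add: fourier_coeff_def dist_scale_def)

lemma distributions_0: "0 \<in> distributions"
  by (simp add: distributions_def zero_fun_def)

lemma distributions_add:
  assumes "u \<in> distributions" "v \<in> distributions"
  shows "u + v \<in> distributions"
  using continuous_map_add[OF distributionsD(3)[OF assms(1)] distributionsD(3)[OF assms(2)]]
    distributionsD[OF assms(1)] distributionsD[OF assms(2)]
  by (auto simp: distributions_def plus_fun_def algebra_simps)

lemma distributions_scale:
  assumes "u \<in> distributions"
  shows "dist_scale c u \<in> distributions"
proof -
  have "continuous_map test_topology euclidean (\<lambda>\<phi>. c * u \<phi>)"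
    using continuous_map_compose[OF distributionsD(3)[OF assms], of euclidean "\<lambda>z. c * z"]
    by (simp add: o_def continuous_intros)
  thus ?thesis
    using distributionsD[OF assms] by (auto simp: distributions_def dist_scale_def algebra_simps)
qed

lemma jbracket_pos: "0 < jbracket k"
  by (simp add: jbracket_def add_pos_nonneg)

text \<open>As a square, the term puts the Sobolev norm in the form of an \<open>\<ell>\<^sup>2\<close> norm.\<close>

lemma sobolev_term_eq: "sobolev_term s u k = (jbracket k powr s * cmod (fourier_coeff u k))\<^sup>2"
  using jbracket_pos[of k] by (simp add: sobolev_term_def power_mult_distrib powr_power)

lemma sobolev_term_0: "sobolev_term s 0 = (\<lambda>k. 0)"
  by (simp add: fun_eq_iff sobolev_term_def fourier_coeff_def)

lemma sobolev_space_0: "0 \<in> sobolev_space s"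
  by (simp add: sobolev_space_def distributions_0 sobolev_term_0)

lemma sobolev_add:
  assumes "u \<in> sobolev_space s" "v \<in> sobolev_space s"
  shows "u + v \<in> sobolev_space s" "sobolev_norm s (u + v) \<le> sobolev_norm s u + sobolev_norm s v"
proof -
  let ?a = "\<lambda>u k. jbracket k powr s * cmod (fourier_coeff u k)"
  have "0 \<le> ?a (u + v) k \<and> ?a (u + v) k \<le> ?a u k + ?a v k" for k
    unfolding fourier_coeff_add distrib_left[symmetric]
    by (intro conjI mult_left_mono norm_triangle_ineq mult_nonneg_nonneg) auto
  note tri = sqrt_infsum_squares_triangle[of "?a u" int_lattice "?a v" "?a (u + v)", OF _ _ this]
  show "u + v \<in> sobolev_space s" "sobolev_norm s (u + v) \<le> sobolev_norm s u + sobolev_norm s v"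
    using tri assms distributions_add[of u v]
    by (simp_all add: sobolev_space_def sobolev_norm_def sobolev_term_eq[abs_def])
qed

lemma sobolev_scale:
  assumes "u \<in> sobolev_space s"
  shows "dist_scale c u \<in> sobolev_space s" "sobolev_norm s (dist_scale c u) = cmod c * sobolev_norm s u"
proof -
  have t: "sobolev_term s (dist_scale c u) = (\<lambda>k. (cmod c)\<^sup>2 * sobolev_term s u k)"
    by (simp add: sobolev_term_def fourier_coeff_scale norm_mult power_mult_distrib fun_eq_iff)
  show "dist_scale c u \<in> sobolev_space s"
    using assms by (simp add: sobolev_space_def t distributions_scale summable_on_cmult_right)
  show "sobolev_norm s (dist_scale c u) = cmod c * sobolev_norm s u"
    by (simp add: sobolev_norm_def t infsum_cmult_right' real_sqrt_mult)
qed

lemma sobolev_norm_nonneg: "0 \<le> sobolev_norm s u"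
  by (simp add: sobolev_norm_def sobolev_term_eq infsum_nonneg)

lemma sobolev_norm_eq_0:
  assumes u: "u \<in> sobolev_space s" and 0: "sobolev_norm s u = 0"
  shows "u = 0"
proof (rule distribution_eq_0I)
  fix k :: "real ^ 'a" assume k: "k \<in> int_lattice"
  have "sobolev_term s u k = 0"
  proof (rule nonneg_infsum_le_0D[OF _ _ _ k])
    show "infsum (sobolev_term s u) int_lattice \<le> 0" using 0 by (simp add: sobolev_norm_def)
    show "sobolev_term s u summable_on int_lattice" using u by (simp add: sobolev_space_def)
  qed (simp add: sobolev_term_eq)
  thus "fourier_coeff u k = 0" using jbracket_pos[of k] by (simp add: sobolev_term_def)
qed (use u in \<open>simp add: sobolev_space_def\<close>)

lemma vector_space_dist_scale: "vector_space dist_scale"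
  by unfold_locales (auto simp: dist_scale_def algebra_simps)

lemma vector_space_family_scale: "vector_space family_scale"
  by unfold_locales (auto simp: family_scale_def dist_scale_def fun_eq_iff algebra_simps)

lemma normed_space_on_sobolev: "normed_space_on dist_scale (sobolev_space s) (sobolev_norm s)"
proof -
  have "module dist_scale" using vector_space_dist_scale by (simp add: module_iff_vector_space)
  hence "module.subspace dist_scale (sobolev_space s)"
    by (simp add: module.subspace_def[OF \<open>module dist_scale\<close>] sobolev_space_0 sobolev_add sobolev_scale)
  moreover have "sobolev_norm s 0 = 0"
    by (simp add: sobolev_norm_def sobolev_term_0)
  ultimately show ?thesis
    using sobolev_norm_eq_0
    by (auto simp: normed_space_on_def vector_space_dist_scale sobolev_norm_nonneg sobolev_add sobolev_scale)
qed

lemma linear_isometry_onto_image: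
  assumes V: "normed_space_on sc V N" and sc': "vector_space sc'"
    and add: "\<And>x y. x \<in> V \<Longrightarrow> y \<in> V \<Longrightarrow> T (x + y) = T x + T y"
    and scale: "\<And>c x. x \<in> V \<Longrightarrow> T (sc c x) = sc' c (T x)"
    and norm: "\<And>x. x \<in> V \<Longrightarrow> N' (T x) = N x"
  shows "linear_isometry sc V N sc' (T ` V) N' T"
proof -
  have mods: "module sc" "module sc'"
    using V sc' by (auto simp: normed_space_on_def module_iff_vector_space)
  interpret S: module sc by fact
  interpret S': module sc' by fact
  have sub: "S.subspace V" using V by (simp add: normed_space_on_def)
  have T0: "T 0 = 0" using scale[OF S.subspace_0[OF sub], of 0] by simp
  have N0: "N x = 0 \<longleftrightarrow> x = 0" if "x \<in> V" for x using V that by (simp add: normed_space_on_def)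
  have kernel: "x = 0" if "x \<in> V" "T x = 0" for x
    using norm[OF that(1)] norm[OF S.subspace_0[OF sub]] N0[OF that(1)] N0[OF S.subspace_0[OF sub]] that(2) T0
    by simp
  have inj: "inj_on T V"
  proof (rule inj_onI)
    fix x y assume xy: "x \<in> V" "y \<in> V" "T x = T y"
    have "- y = sc (-1) y" by simp
    hence "T (x + - y) = T x + sc' (-1) (T y)"
      using xy add scale S.subspace_neg[OF sub] by metis
    hence "T (x - y) = 0" using xy by simp
    thus "x = y" using kernel[OF S.subspace_diff[OF sub xy(1,2)]] by simp
  qed
  have sub': "S'.subspace (T ` V)"
  proof (rule S'.subspaceI)
    show "0 \<in> T ` V" using T0 S.subspace_0[OF sub] by (metis image_eqI)
    show "x + y \<in> T ` V" if "x \<in> T ` V" "y \<in> T ` V" for x y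
      using that S.subspace_add[OF sub] by (auto simp flip: add)
    show "sc' c x \<in> T ` V" if "x \<in> T ` V" for c x
      using that S.subspace_scale[OF sub] by (auto simp flip: scale)
  qed
  have "normed_space_on sc' (T ` V) N'"
    using V sc' sub' kernel T0 S.subspace_add[OF sub] S.subspace_scale[OF sub]
    by (auto simp: normed_space_on_def norm simp flip: add scale)
  thus ?thesis
    using V inj by (auto simp: linear_isometry_def inj_on_imp_bij_betw add scale norm)
qed

lemma radon_add: "radon d (u + v) = radon d u + radon d v"
  and radon_scale: "radon d (dist_scale c u) = family_scale c (radon d u)"
  by (simp_all add: radon_def family_scale_def dist_scale_def fun_eq_iff)

theorem theorem5:
  fixes d :: nat
  assumes "2 \<le> CARD('n::finite)" and "1 \<le> d" and "d < CARD('n)"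
  shows "(\<forall>f \<in> (distributions :: ((real ^ 'n \<Rightarrow> complex) \<Rightarrow> complex) set). \<forall>k \<in> int_lattice.
            is_max_over (cmod (fourier_coeff f k))
              (\<lambda>A. cmod (fourier_coeff (radon d f A) k)) (direction_sets d)) \<and>
         (\<forall>s :: real.
            (\<forall>F \<in> radon d ` (sobolev_space s :: ((real ^ 'n \<Rightarrow> complex) \<Rightarrow> complex) set).
               radon_term d s F summable_on int_lattice) \<and>
            linear_isometry
              dist_scale (sobolev_space s :: ((real ^ 'n \<Rightarrow> complex) \<Rightarrow> complex) set) (sobolev_norm s)
              family_scale (radon d ` sobolev_space s) (radon_norm d s)
              (radon d))"
proof (intro conjI ballI allI)
  fix f :: "(real ^ 'n \<Rightarrow> complex) \<Rightarrow> complex" and k :: "real ^ 'n"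
  assume "f \<in> distributions" "k \<in> int_lattice"
  thus "is_max_over (cmod (fourier_coeff f k))
      (\<lambda>A. cmod (fourier_coeff (radon d f A) k)) (direction_sets d)"
    using assms(3) by (intro fourier_coeff_radon_max) auto
next
  fix s and F :: "(real ^ 'n) set \<Rightarrow> (real ^ 'n \<Rightarrow> complex) \<Rightarrow> complex"
  assume "F \<in> radon d ` sobolev_space s"
  then obtain f where f: "F = radon d f" "f \<in> distributions" "sobolev_term s f summable_on int_lattice"
    by (auto simp: sobolev_space_def)
  thus "radon_term d s F summable_on int_lattice"
    using radon_term_radon[OF f(2) _ assms(3), of _ s] by (simp cong: summable_on_cong)
next
  fix s
  have "radon_norm d s (radon d f) = sobolev_norm s f"
    if "f \<in> sobolev_space s" for f :: "(real ^ 'n \<Rightarrow> complex) \<Rightarrow> complex"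
    using that radon_term_radon[OF _ _ assms(3), of f _ s]
    by (simp add: radon_norm_def sobolev_norm_def sobolev_space_def cong: infsum_cong)
  thus "linear_isometry dist_scale (sobolev_space s :: ((real ^ 'n \<Rightarrow> complex) \<Rightarrow> complex) set)
      (sobolev_norm s) family_scale (radon d ` sobolev_space s) (radon_norm d s) (radon d)"
    by (intro linear_isometry_onto_image normed_space_on_sobolev vector_space_family_scale
        radon_add radon_scale)
qed

end
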